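(* Let $G$ and $H$ be two graphs with no isolated vertices. Assume that $q(G) = q(H) = 2$ and $MB(G) = MB(H)$. Then $q(G \vee H) = 2$ and $MB(G \vee H) \leq MB(G)\ (= MB(H))$.
   Context: All graphs are finite and simple. For a graph $G$ on $n$ vertices, $\mathcal{S}(G)$ is the set of real symmetric $n\times n$ matrices $A=[a_{ij}]$ (indexed by the vertices) such that for $i\neq j$, $a_{ij}\neq 0$ if and only if $ij$ is an edge of $G$; the diagonal entries are arbitrary. $q(A)$ is the number of distinct eigenvalues of $A$, and $q(G)=\min\{q(A): A\in\mathcal{S}(G)\}$. A graph $G$ on $n$ vertices achieves the multiplicity bipartition $[n-k,k]$, where $1\le k\leq\lfloor n/2\rfloor$, if some $A\in\mathcal{S}(G)$ has exactly two distinct eigenvalues, with multiplicities $n-k$ and $k$. For a graph $G$ with $q(G)=2$, $MB(G)$ is the least integer $k\leq \lfloor n/2\rfloor$ such that $G$ achieves $[n-k,k]$. $G\vee H$ denotes the join (disjoint union of $G$ and $H$ plus all edges between $V(G)$ and $V(H)$). *)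

theory Defs
  imports "HOL-Analysis.Analysis"
begin

text \<open>
  A finite graph is given by its adjacency relation on a finite vertex type, so that its matrices
  can be indexed by the vertices themselves and its order is the cardinality of the type.
\<close>

definition simple_graph :: "('v::finite \<Rightarrow> 'v \<Rightarrow> bool) \<Rightarrow> bool" where
  "simple_graph G \<longleftrightarrow> symp G \<and> irreflp G"

definition no_isolated_vertices :: "('v::finite \<Rightarrow> 'v \<Rightarrow> bool) \<Rightarrow> bool" where
  "no_isolated_vertices G \<longleftrightarrow> (\<forall>v. \<exists>w. G v w)"

fun graph_join ::
  "('v::finite \<Rightarrow> 'v \<Rightarrow> bool) \<Rightarrow> ('w::finite \<Rightarrow> 'w \<Rightarrow> bool) \<Rightarrow> 'v + 'w \<Rightarrow> 'v + 'w \<Rightarrow> bool"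
where
  "graph_join G H (Inl u) (Inl v) \<longleftrightarrow> G u v"
| "graph_join G H (Inr u) (Inr v) \<longleftrightarrow> H u v"
| "graph_join G H (Inl u) (Inr v) \<longleftrightarrow> True"
| "graph_join G H (Inr u) (Inl v) \<longleftrightarrow> True"

lemma simple_graph_join:
  assumes "simple_graph G" and "simple_graph H"
  shows "simple_graph (graph_join G H)"
proof -
  have "graph_join G H y x" if "graph_join G H x y" for x y
    using that assms by (cases x; cases y) (auto simp: simple_graph_def dest: sympD)
  moreover have "\<not> graph_join G H x x" for x
    using assms by (cases x) (auto simp: simple_graph_def dest: irreflpD)
  ultimately show ?thesis
    by (auto simp: simple_graph_def intro: sympI irreflpI)
qed

definition sym_matrices :: "('v::finite \<Rightarrow> 'v \<Rightarrow> bool) \<Rightarrow> (real ^ 'v ^ 'v) set" where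
  "sym_matrices G =
    {A. transpose A = A \<and> (\<forall>i j. i \<noteq> j \<longrightarrow> (A $ i $ j \<noteq> 0 \<longleftrightarrow> G i j))}"

definition eigenspace :: "real ^ 'v ^ 'v \<Rightarrow> real \<Rightarrow> (real ^ 'v::finite) set" where
  "eigenspace A c = {x. A *v x = c *\<^sub>R x}"

definition eigenvalues :: "real ^ 'v ^ 'v::finite \<Rightarrow> real set" where
  "eigenvalues A = {c. \<exists>x. x \<noteq> 0 \<and> A *v x = c *\<^sub>R x}"

text \<open>
  Multiplicity is the dimension of the eigenspace.  It is only used for real symmetric matrices,
  for which geometric and algebraic multiplicities agree.
\<close>

definition eigen_mult :: "real ^ 'v ^ 'v::finite \<Rightarrow> real \<Rightarrow> nat" where
  "eigen_mult A c = dim (eigenspace A c)"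

definition num_eigenvalues :: "real ^ 'v ^ 'v::finite \<Rightarrow> nat" where
  "num_eigenvalues A = card (eigenvalues A)"

definition q_graph :: "('v::finite \<Rightarrow> 'v \<Rightarrow> bool) \<Rightarrow> nat" where
  "q_graph G = (LEAST m. \<exists>A\<in>sym_matrices G. num_eigenvalues A = m)"

text \<open>\<open>G\<close> achieves the multiplicity bipartition \<open>[n - k, k]\<close>, with \<open>n\<close> the order of \<open>G\<close>.\<close>

definition achieves_bipartition :: "('v::finite \<Rightarrow> 'v \<Rightarrow> bool) \<Rightarrow> nat \<Rightarrow> bool" where
  "achieves_bipartition G k \<longleftrightarrow>
    1 \<le> k \<and> k \<le> CARD('v) div 2 \<and>
    (\<exists>A\<in>sym_matrices G. \<exists>a b. a \<noteq> b \<and> eigenvalues A = {a, b} \<and>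
       eigen_mult A a = CARD('v) - k \<and> eigen_mult A b = k)"

text \<open>
  Meaningful when \<open>q_graph G = 2\<close>: a matrix with exactly two distinct eigenvalues then exists,
  and its smaller multiplicity is a \<open>k\<close> for which \<open>achieves_bipartition G k\<close> holds.
\<close>

definition MB :: "('v::finite \<Rightarrow> 'v \<Rightarrow> bool) \<Rightarrow> nat" where
  "MB G = (LEAST k. achieves_bipartition G k)"

end

theory Submission
  imports Defs
begin

text \<open>
  Normalise matrices achieving \<open>[n - k, k]\<close> for \<open>G\<close> and \<open>H\<close> to orthogonal projections \<open>P\<close>, \<open>Q\<close> of
  rank \<open>k\<close>.  For an isometry \<open>T\<close> from the range of \<open>P\<close> onto the range of \<open>Q\<close> and \<open>M = T P\<close>, the
  block matrix \<open>C\<close> with rows \<open>(P, M\<^sup>T)\<close> and \<open>(M, Q)\<close> satisfies \<open>C\<^sup>2 = 2 C\<close>, and its eigenspace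
  for 2 is the graph of \<open>T\<close>, of dimension \<open>k\<close>.  Since there are no isolated vertices, the columns
  of \<open>P\<close> and \<open>Q\<close> are nonzero, and for \<open>T\<close> in general position all entries of \<open>M\<close> are nonzero, so
  that \<open>C\<close> is a matrix of the join.
\<close>

text \<open>As a simp rule this would rewrite \<open>transpose M *v y\<close>, the form in which
  identities about adjoints are stated below.\<close>

declare transpose_matrix_vector [simp del]

section \<open>Spectral theory of real symmetric matrices\<close>

lemma symmetric_inner:
  assumes "transpose A = (A :: real^'n^'n)"
  shows "(A *v x) \<bullet> y = x \<bullet> (A *v y)"
  by (metis assms dot_lmul_matrix transpose_matrix_vector)

lemma transpose_inner: "(transpose A *v y) \<bullet> x = y \<bullet> ((A :: real^'n^'m) *v x)"
  by (metis dot_lmul_matrix transpose_matrix_vector)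

lemma subspace_eigenspace: "subspace (eigenspace A c)"
  by (auto simp: eigenspace_def subspace_def matrix_vector_mult_add_rdistrib matrix_vector_right_distrib
      matrix_vector_mult_scaleR scaleR_right_distrib)

lemma mem_eigenvalues_iff: "c \<in> eigenvalues A \<longleftrightarrow> \<not> eigenspace A c \<subseteq> {0}"
  by (auto simp: eigenvalues_def eigenspace_def)

lemma eigenvalues_iff_eigen_mult: "c \<in> eigenvalues A \<longleftrightarrow> 0 < eigen_mult A c"
  unfolding mem_eigenvalues_iff eigen_mult_def by (metis dim_eq_0 neq0_conv)

text \<open>First-order condition at a minimum: the polynomial vanishes at 0 and is nowhere
  negative, so its derivative \<open>b\<close> there is zero.\<close>

lemma linear_coefficient_zero_if_nonneg:
  fixes b c :: real
  assumes "\<And>t. 0 \<le> t * b + t\<^sup>2 * c"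
  shows "b = 0"
proof (rule ccontr)
  assume "b \<noteq> 0"
  \<comment> \<open>Any positive \<open>d\<close> above \<open>c\<close> serves: at
    \<open>t = - b / d\<close> the polynomial equals
    \<open>(b / d)\<^sup>2 * (c - d) < 0\<close>.\<close>
  define d where "d = \<bar>c\<bar> + 1"
  have d: "d > 0" "c < d"
    unfolding d_def by auto
  have "0 \<le> (- b / d) * b + (- b / d)\<^sup>2 * c"
    by (rule assms)
  also have "\<dots> = (b / d)\<^sup>2 * (c - d)"
    using d by (simp add: field_simps power2_eq_square)
  also have "\<dots> < 0"
    using d \<open>b \<noteq> 0\<close> by (intro mult_pos_neg) auto
  finally show False by simp
qed

text \<open>A maximiser of the Rayleigh quotient on an invariant subspace is an eigenvector.\<close>
lemma symmetric_eigenvector_in_invariant_subspace: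
  fixes A :: "real^'n^'n"
  assumes sym: "transpose A = A" and S: "subspace S"
    and inv: "\<And>x. x \<in> S \<Longrightarrow> A *v x \<in> S" and nontriv: "\<not> S \<subseteq> {0}"
  obtains x c where "x \<in> S" "x \<noteq> 0" "A *v x = c *\<^sub>R x"
proof -
  have "compact (S \<inter> sphere 0 1)"
    using closed_subspace[OF S] by (simp add: closed_Int_compact)
  moreover have "S \<inter> sphere 0 1 \<noteq> {}"
  proof -
    obtain y where "y \<in> S" "y \<noteq> 0" using nontriv by auto
    then have "y /\<^sub>R norm y \<in> S \<inter> sphere 0 1"
      using S by (simp add: subspace_scale)
    then show ?thesis by blast
  qed
  moreover have "continuous_on (S \<inter> sphere 0 1) (\<lambda>x. x \<bullet> (A *v x))"
    by (intro continuous_intros linear_continuous_on matrix_vector_mul_bounded_linear)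
  ultimately have "\<exists>x\<in>S \<inter> sphere 0 1. \<forall>y\<in>S \<inter> sphere 0 1. y \<bullet> (A *v y) \<le> x \<bullet> (A *v x)"
    by (rule continuous_attains_sup)
  then obtain x where x: "x \<in> S" "norm x = 1"
    and max: "\<And>y. y \<in> S \<Longrightarrow> norm y = 1 \<Longrightarrow> y \<bullet> (A *v y) \<le> x \<bullet> (A *v x)"
    by fastforce
  define c where "c = x \<bullet> (A *v x)"
  \<comment> \<open>The quadratic form of \<open>c\<close> times the identity minus
    \<open>A\<close>. By homogeneity, maximality of \<open>c\<close> on the unit sphere makes it
    nonnegative on all of \<open>S\<close>, with a zero at \<open>x\<close>.\<close>
  define g where "g y = c * (y \<bullet> y) - y \<bullet> (A *v y)" for y
  have g_nonneg: "0 \<le> g y" if "y \<in> S" for y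
  proof (cases "y = 0")
    case False
    then have "(y /\<^sub>R norm y) \<bullet> (A *v (y /\<^sub>R norm y)) \<le> c"
      unfolding c_def using that S by (intro max) (auto simp: subspace_scale)
    then have "(y \<bullet> (A *v y)) / (norm y)\<^sup>2 \<le> c"
      by (simp add: matrix_vector_mult_scaleR power2_eq_square field_simps)
    then show ?thesis
      using False by (simp add: g_def divide_le_eq power2_norm_eq_inner)
  qed (simp add: g_def)
  \<comment> \<open>Half the gradient of \<open>g\<close> at \<open>x\<close>, and a direction
    inside \<open>S\<close> by invariance. Moving from \<open>x\<close> along \<open>z\<close>
    changes \<open>g\<close> to first order by \<open>2 * (z \<bullet> z)\<close>, which must
    vanish.\<close>
  define z where "z = c *\<^sub>R x - A *v x"
  have zS: "z \<in> S"
    unfolding z_def using S x inv by (simp add: subspace_diff subspace_scale)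
  have "0 \<le> t * (2 * (z \<bullet> z)) + t\<^sup>2 * g z" for t
  proof -
    have "x \<bullet> x = 1" using x by (simp add: norm_eq_1)
    then have g0: "g x = 0" by (simp add: g_def c_def)
    have "g (x + t *\<^sub>R z) = g x + t * (2 * (c * (x \<bullet> z) - (A *v x) \<bullet> z)) + t\<^sup>2 * g z"
      using symmetric_inner[OF sym, of x z] inner_commute[of z "A *v x"] inner_commute[of x z]
      by (simp add: g_def matrix_vector_right_distrib matrix_vector_mult_scaleR algebra_simps
          inner_add_left inner_add_right power2_eq_square)
    moreover have "z \<bullet> z = c * (x \<bullet> z) - (A *v x) \<bullet> z"
      by (metis z_def inner_diff_left inner_scaleR_left)
    ultimately show ?thesis
      using g_nonneg[of "x + t *\<^sub>R z"] g0 x(1) zS S by (simp add: subspace_add subspace_scale)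
  qed
  then have "z = 0"
    using linear_coefficient_zero_if_nonneg by fastforce
  moreover have "x \<noteq> 0" using x(2) by force
  ultimately show ?thesis
    using that[of x c] x(1) z_def by auto
qed

lemma eigenvectors_orthogonal:
  assumes "transpose A = (A :: real^'n^'n)" "A *v x = a *\<^sub>R x" "A *v y = b *\<^sub>R y" "a \<noteq> b"
  shows "x \<bullet> y = 0"
  using symmetric_inner[OF assms(1), of x y] assms by simp

text \<open>Choosing one eigenvector per eigenvalue gives pairwise orthogonal nonzero vectors, of
  which a finite-dimensional space has only finitely many.\<close>

lemma finite_eigenvalues:
  assumes "transpose A = (A :: real^'n^'n)"
  shows "finite (eigenvalues A)"
proof -
  have "\<forall>c\<in>eigenvalues A. \<exists>x. x \<noteq> 0 \<and> A *v x = c *\<^sub>R x"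
    by (simp add: eigenvalues_def)
  from bchoice[OF this] obtain f
    where f: "\<And>c. c \<in> eigenvalues A \<Longrightarrow> f c \<noteq> 0 \<and> A *v f c = c *\<^sub>R f c"
    by blast
  have orth: "f c \<bullet> f d = 0" if "c \<in> eigenvalues A" "d \<in> eigenvalues A" "c \<noteq> d" for c d
    using eigenvectors_orthogonal[OF assms] f that by blast
  then have "pairwise orthogonal (f ` eigenvalues A)"
    by (auto simp: pairwise_def orthogonal_def)
  then have "finite (f ` eigenvalues A)"
    by (rule pairwise_orthogonal_imp_finite)
  moreover have "inj_on f (eigenvalues A)"
    by (rule inj_onI) (metis f inner_eq_zero_iff orth)
  ultimately show ?thesis
    using finite_imageD by blast
qed

text \<open>By symmetry the orthogonal complement of all eigenspaces is invariant. If it were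
  nonzero it would contain an eigenvector, which would be orthogonal to itself.\<close>

lemma span_eigenspaces:
  fixes A :: "real^'n^'n"
  assumes sym: "transpose A = A"
  shows "span (\<Union>c. eigenspace A c) = UNIV"
proof (rule ccontr)
  let ?E = "\<Union>c. eigenspace A c"
  define S where "S = {x. \<forall>y\<in>?E. orthogonal x y}"
  assume "span ?E \<noteq> UNIV"
  then have "dim ?E < DIM(real^'n)"
    using dim_subset_UNIV[of ?E] dim_eq_full[of ?E] by linarith
  then obtain w where w: "w \<noteq> 0" "\<And>y. y \<in> span ?E \<Longrightarrow> orthogonal w y"
    using orthogonal_to_subspace_exists[of ?E] by blast
  then have "w \<in> S"
    by (auto simp: S_def intro: span_base)
  moreover have "subspace S"
    by (auto simp: S_def subspace_def orthogonal_def inner_add_left)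
  moreover have "A *v x \<in> S" if "x \<in> S" for x
    using that by (auto simp: S_def orthogonal_def symmetric_inner[OF sym] eigenspace_def)
  ultimately obtain x c where x: "x \<in> S" "x \<noteq> 0" "A *v x = c *\<^sub>R x"
    using symmetric_eigenvector_in_invariant_subspace[OF sym] w(1) by blast
  then have "orthogonal x x"
    by (auto simp: S_def eigenspace_def)
  then show False
    using x by (simp add: orthogonal_def)
qed

lemma span_eigenspaces_eigenvalues:
  fixes A :: "real^'n^'n"
  assumes sym: "transpose A = A"
  shows "span (\<Union>c\<in>eigenvalues A. eigenspace A c) = UNIV"
proof -
  have "(\<Union>c. eigenspace A c) \<subseteq> insert 0 (\<Union>c\<in>eigenvalues A. eigenspace A c)"
    using mem_eigenvalues_iff by blast
  then have "span (\<Union>c. eigenspace A c) \<subseteq> span (insert 0 (\<Union>c\<in>eigenvalues A. eigenspace A c))"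
    by (rule span_mono)
  then show ?thesis
    using span_eigenspaces[OF sym] by (auto simp: span_insert_0)
qed

lemma eigenspace_sum_UNIV:
  fixes A :: "real^'n^'n"
  assumes sym: "transpose A = A" and ev: "eigenvalues A = {a, b}"
  shows "{x + y | x y. x \<in> eigenspace A a \<and> y \<in> eigenspace A b} = UNIV"
proof -
  have "span (eigenspace A a \<union> eigenspace A b) = UNIV"
    using span_eigenspaces_eigenvalues[OF sym] ev by simp
  then show ?thesis
    using subspace_eigenspace[of A a] subspace_eigenspace[of A b]
    unfolding span_Un by (simp add: span_eq_iff[THEN iffD2] cong: conj_cong)
qed

text \<open>Assumes the decomposition instead of symmetry and a known spectrum, so that it also
  applies to the block matrix of the join before its eigenvalues are determined.\<close>

lemma eigen_mult_add:
  fixes A :: "real^'n^'n"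
  assumes "a \<noteq> b" "{x + y | x y. x \<in> eigenspace A a \<and> y \<in> eigenspace A b} = UNIV"
  shows "eigen_mult A a + eigen_mult A b = CARD('n)"
proof -
  have "eigenspace A a \<inter> eigenspace A b = {0}"
    using assms(1) by (auto simp: eigenspace_def)
  then show ?thesis
    using dim_sums_Int[OF subspace_eigenspace[of A a] subspace_eigenspace[of A b]] assms(2)
    by (simp add: eigen_mult_def)
qed

section \<open>Matrices of a graph and their normalisation to projections\<close>

text \<open>With at most one eigenvalue, the spanning eigenspaces would make every vector an
  eigenvector for the same \<open>a\<close>, so \<open>A\<close> would be a scalar matrix, against
  its nonzero entry at the edge.\<close>

lemma num_eigenvalues_ge_2:
  fixes A :: "real^'v^'v"
  assumes A: "A \<in> sym_matrices G" and edge: "G i j" "i \<noteq> j"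
  shows "2 \<le> num_eigenvalues A"
proof (rule ccontr)
  have sym: "transpose A = A" and Aij: "A $ i $ j \<noteq> 0"
    using A edge by (auto simp: sym_matrices_def)
  assume "\<not> 2 \<le> num_eigenvalues A"
  then have "card (eigenvalues A) \<le> Suc 0"
    by (simp add: num_eigenvalues_def)
  then obtain a where "eigenvalues A \<subseteq> {a}"
    using finite_eigenvalues[OF sym] card_le_Suc0_iff_eq[of "eigenvalues A"] by blast
  then have "(\<Union>c\<in>eigenvalues A. eigenspace A c) \<subseteq> eigenspace A a"
    by auto
  then have "span (\<Union>c\<in>eigenvalues A. eigenspace A c) \<subseteq> eigenspace A a"
    by (simp add: span_minimal subspace_eigenspace)
  then have "axis j 1 \<in> eigenspace A a"
    using span_eigenspaces_eigenvalues[OF sym] by auto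
  then have "column j A = a *\<^sub>R axis j 1"
    by (simp add: eigenspace_def matrix_vector_mul_component matrix_vector_mult_basis)
  then have "A $ i $ j = a * axis j 1 $ i"
    by (metis column_def vec_lambda_beta vector_scaleR_component real_scaleR_def)
  then show False
    using Aij edge by (simp add: axis_def)
qed

lemma sym_matrices_nonempty:
  fixes G :: "'v::finite \<Rightarrow> 'v \<Rightarrow> bool"
  assumes "simple_graph G"
  shows "sym_matrices G \<noteq> {}"
proof -
  have "(\<chi> i j. if G i j then 1 else 0) \<in> sym_matrices G"
    using assms by (auto simp: sym_matrices_def simple_graph_def transpose_def vec_eq_iff dest: sympD)
  then show ?thesis by blast
qed

lemma achieves_bipartition_if_two_eigenvalues:
  fixes A :: "real^'v^'v"
  assumes A: "A \<in> sym_matrices G" and n2: "num_eigenvalues A = 2"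
  shows "\<exists>k. achieves_bipartition G k"
proof -
  have sym: "transpose A = A"
    using A by (auto simp: sym_matrices_def)
  obtain a b where ab: "a \<noteq> b" "eigenvalues A = {a, b}"
    using n2 by (auto simp: num_eigenvalues_def card_2_iff)
  note sum = eigen_mult_add[OF ab(1) eigenspace_sum_UNIV[OF sym ab(2)]]
  have pos: "0 < eigen_mult A a" "0 < eigen_mult A b"
    using ab by (auto simp flip: eigenvalues_iff_eigen_mult)
  \<comment> \<open>The definition wants the smaller multiplicity second, so the claim is proved for
    either naming of the two eigenvalues.\<close>
  have "achieves_bipartition G (eigen_mult A d)"
    if "eigenvalues A = {c, d}" "c \<noteq> d" "eigen_mult A c + eigen_mult A d = CARD('v)"
      "0 < eigen_mult A d" "eigen_mult A d \<le> eigen_mult A c" for c d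
  proof -
    have "\<exists>a b. a \<noteq> b \<and> eigenvalues A = {a, b} \<and>
        eigen_mult A a = CARD('v) - eigen_mult A d \<and> eigen_mult A b = eigen_mult A d"
      using that by (metis add_diff_cancel_right')
    moreover have "1 \<le> eigen_mult A d" "eigen_mult A d \<le> CARD('v) div 2"
      using that by linarith+
    ultimately show ?thesis
      unfolding achieves_bipartition_def using A by blast
  qed
  from this[of a b] this[of b a] show ?thesis
    using ab sum pos by (metis add.commute insert_commute nle_le)
qed

text \<open>Both minima are attained: that of \<open>q_graph\<close> because \<open>G\<close> has a
  matrix at all, that of \<open>MB\<close> because a matrix with two eigenvalues yields some
  bipartition.\<close>

lemma achieves_bipartition_MB:
  assumes "simple_graph G" "q_graph G = 2"
  shows "achieves_bipartition G (MB G)"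
proof -
  have "\<exists>m. \<exists>A\<in>sym_matrices G. num_eigenvalues A = m"
    using sym_matrices_nonempty[OF assms(1)] by blast
  then have "\<exists>A\<in>sym_matrices G. num_eigenvalues A = 2"
    using LeastI_ex[of "\<lambda>m. \<exists>A\<in>sym_matrices G. num_eigenvalues A = m"] assms(2)
    unfolding q_graph_def by simp
  then show ?thesis
    using achieves_bipartition_if_two_eigenvalues LeastI_ex unfolding MB_def by blast
qed

text \<open>The affine map taking \<open>a\<close> to 0 and \<open>b\<close> to 1 turns a
  two-eigenvalue matrix into the projection onto the eigenspace of \<open>b\<close>. Its nonzero
  slope preserves the off-diagonal pattern.\<close>

lemma achieves_bipartition_projection:
  fixes G :: "'v::finite \<Rightarrow> 'v \<Rightarrow> bool"
  assumes "achieves_bipartition G k"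
  obtains P where "P \<in> sym_matrices G" "\<And>x. P *v (P *v x) = P *v x" "dim (eigenspace P 1) = k"
proof -
  obtain A a b where A: "A \<in> sym_matrices G" and ab: "a \<noteq> b" "eigenvalues A = {a, b}"
    and k: "eigen_mult A b = k"
    using assms by (auto simp: achieves_bipartition_def)
  define P where "P = (1 / (b - a)) *\<^sub>R (A - a *\<^sub>R mat 1)"
  have Pv: "P *v x = (1 / (b - a)) *\<^sub>R (A *v x - a *\<^sub>R x)" for x
    by (simp add: P_def scaleR_matrix_vector_assoc[symmetric] matrix_vector_mult_diff_rdistrib)
  have Pa: "P *v x = 0" if "x \<in> eigenspace A a" for x
    using that by (simp add: Pv eigenspace_def)
  have Pb: "P *v x = x" if "x \<in> eigenspace A b" for x
    using that ab by (simp add: Pv eigenspace_def flip: scaleR_diff_left)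
  have sym: "transpose A = A"
    using A by (auto simp: sym_matrices_def)
  show ?thesis
  proof
    show "P \<in> sym_matrices G"
      using A ab by (auto simp: P_def sym_matrices_def transpose_def vec_eq_iff mat_def)
    show "P *v (P *v x) = P *v x" for x
    proof -
      obtain y z where "x = y + z" "y \<in> eigenspace A a" "z \<in> eigenspace A b"
        using eigenspace_sum_UNIV[OF sym ab(2)] by blast
      then show ?thesis
        by (simp add: matrix_vector_right_distrib Pa Pb)
    qed
    have "eigenspace P 1 = eigenspace A b"
    proof
      show "eigenspace P 1 \<subseteq> eigenspace A b"
      proof
        fix x assume "x \<in> eigenspace P 1"
        then have "(1 / (b - a)) *\<^sub>R (A *v x - a *\<^sub>R x) = x"
          by (simp add: eigenspace_def Pv)
        then have "(b - a) *\<^sub>R x = A *v x - a *\<^sub>R x"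
          using ab(1) by (metis divide_inverse eq_iff_diff_eq_0 left_inverse mult.left_neutral
              right_inverse scaleR_one scaleR_scaleR)
        then show "x \<in> eigenspace A b"
          by (simp add: eigenspace_def algebra_simps)
      qed
    qed (use Pb in \<open>auto simp: eigenspace_def\<close>)
    then show "dim (eigenspace P 1) = k"
      using k by (simp add: eigen_mult_def)
  qed
qed

text \<open>This is where isolated vertices are excluded: a neighbour of \<open>i\<close> gives a
  nonzero off-diagonal entry in column \<open>i\<close>.\<close>

lemma column_nonzero_if_not_isolated:
  assumes "simple_graph G" "no_isolated_vertices G" "P \<in> sym_matrices G"
  shows "P *v axis i 1 \<noteq> 0"
proof -
  obtain j where "G i j"
    using assms(2) by (auto simp: no_isolated_vertices_def)
  then have "G j i" "j \<noteq> i"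
    using assms(1) by (auto simp: simple_graph_def dest: sympD irreflpD)
  then have "P $ j $ i \<noteq> 0"
    using assms(3) by (auto simp: sym_matrices_def)
  moreover have "P $ j $ i = (P *v axis i 1) $ j"
    by (simp add: matrix_vector_mult_basis column_def)
  ultimately show ?thesis by auto
qed

section \<open>Isometries in general position\<close>

text \<open>
  For \<open>v \<noteq> 0\<close> this is \<open>v \<bullet> v\<close> times the inner product of \<open>g\<close> with the image of \<open>f\<close> under the
  reflection in the hyperplane orthogonal to \<open>v\<close>.
\<close>
definition reflection_form :: "'a::real_inner \<Rightarrow> 'a \<Rightarrow> 'a \<Rightarrow> real" where
  "reflection_form f g v = (v \<bullet> v) * (f \<bullet> g) - 2 * (v \<bullet> f) * (v \<bullet> g)"

text \<open>The witness is \<open>f\<close> itself, or \<open>f + g\<close> when \<open>f\<close>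
  and \<open>g\<close> are orthogonal.\<close>

lemma reflection_form_nonzero:
  assumes "subspace U" "f \<in> U" "g \<in> U" "f \<noteq> 0" "g \<noteq> 0"
  shows "\<exists>v\<in>U. reflection_form f g v \<noteq> 0"
proof (cases "f \<bullet> g = 0")
  case True
  then have "reflection_form f g (f + g) = - 2 * (f \<bullet> f) * (g \<bullet> g)"
    by (simp add: reflection_form_def inner_add_left inner_add_right inner_commute)
  then show ?thesis
    using assms by (metis inner_eq_zero_iff mult_eq_0_iff neg_equal_0_iff_equal subspace_add zero_neq_numeral)
next
  case False
  have "reflection_form f g f = - (f \<bullet> f) * (f \<bullet> g)"
    by (simp add: reflection_form_def)
  then show ?thesis
    using assms False by (intro bexI[of _ f]) auto
qed

lemma reflection_form_line:
  "\<exists>b. \<forall>t. reflection_form f g (v + t *\<^sub>R w) = reflection_form f g v + b * t + reflection_form f g w * t\<^sup>2"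
  by (rule exI[of _ "2 * (v \<bullet> w) * (f \<bullet> g) - 2 * (v \<bullet> f) * (w \<bullet> g) - 2 * (w \<bullet> f) * (v \<bullet> g)"])
    (simp add: reflection_form_def inner_add_left inner_add_right inner_commute[of w v]
      power2_eq_square algebra_simps)

text \<open>On the line the form is a polynomial in \<open>t\<close> of degree at most 2 whose
  constant and leading coefficients are its values at \<open>v\<close> and \<open>w\<close>; one of
  them being nonzero leaves finitely many roots.\<close>

lemma finite_reflection_form_zeros_on_line:
  assumes "reflection_form f g v \<noteq> 0 \<or> reflection_form f g w \<noteq> 0"
  shows "finite {t. reflection_form f g (v + t *\<^sub>R w) = 0}"
proof -
  obtain b where b: "\<And>t. reflection_form f g (v + t *\<^sub>R w)
      = reflection_form f g v + b * t + reflection_form f g w * t\<^sup>2"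
    using reflection_form_line by blast
  define c where "c i = [reflection_form f g v, b, reflection_form f g w] ! i" for i
  have "reflection_form f g (v + t *\<^sub>R w) = (\<Sum>i\<le>2. c i * t ^ i)" for t
    by (simp add: b c_def numeral_2_eq_2)
  moreover have "\<exists>i\<le>2. c i \<noteq> 0"
    using assms by (auto simp: c_def intro: exI[of _ 0] exI[of _ 2])
  ultimately show ?thesis
    using polyfun_finite_roots[of c 2] by simp
qed

text \<open>Induction on the pairs: start from \<open>v\<close> good for the old pairs and move
  along a \<open>w\<close> good for the new one. Each pair excludes only finitely many parameters on
  this line.\<close>

lemma reflection_form_simultaneously_nonzero:
  assumes U: "subspace U" and "finite I"
    and "\<And>f g. (f, g) \<in> I \<Longrightarrow> f \<in> U \<and> g \<in> U \<and> f \<noteq> 0 \<and> g \<noteq> 0"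
  shows "\<exists>v\<in>U. \<forall>(f, g)\<in>I. reflection_form f g v \<noteq> 0"
  using assms(2,3)
proof (induction I)
  case empty
  then show ?case using subspace_0[OF U] by auto
next
  case (insert p I)
  obtain f0 g0 where p: "p = (f0, g0)" by (cases p)
  obtain v where v: "v \<in> U" "\<forall>(f, g)\<in>I. reflection_form f g v \<noteq> 0"
    using insert by blast
  obtain w where w: "w \<in> U" "reflection_form f0 g0 w \<noteq> 0"
    using reflection_form_nonzero[OF U] insert.prems[of f0 g0] p by auto
  define Z where "Z = (\<Union>(f, g)\<in>insert p I. {t. reflection_form f g (v + t *\<^sub>R w) = 0})"
  have "finite Z"
    unfolding Z_def using insert.hyps(1) v w p by (intro finite_UN_I)
      (auto intro!: finite_reflection_form_zeros_on_line)
  then obtain t where "t \<notin> Z"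
    using ex_new_if_finite[OF infinite_UNIV_char_0] by blast
  then have "\<forall>(f, g)\<in>insert p I. reflection_form f g (v + t *\<^sub>R w) \<noteq> 0"
    by (auto simp: Z_def)
  then show ?case
    using U v w by (meson subspace_add subspace_scale)
qed

text \<open>Polarization, using that norms are preserved at \<open>x + y\<close> too.\<close>

lemma linear_isometry_inner:
  assumes "linear F" "subspace U" "\<And>x. x \<in> U \<Longrightarrow> norm (F x) = norm x" "x \<in> U" "y \<in> U"
  shows "F x \<bullet> F y = x \<bullet> y"
proof -
  have "norm (F x + F y) = norm (x + y)"
    using assms by (metis linear_add subspace_add)
  then show ?thesis
    using assms(3)[OF assms(4)] assms(3)[OF assms(5)] by (simp add: dot_norm)
qed

text \<open>The isometry is a fixed one, preceded by a reflection of \<open>U\<close> in general position.\<close>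
lemma isometry_in_general_position:
  fixes U :: "'a::euclidean_space set" and W :: "'b::euclidean_space set"
  assumes U: "subspace U" and W: "subspace W" and dim: "dim U = dim W"
    and X: "finite X" "X \<subseteq> U - {0}" and Y: "finite Y" "Y \<subseteq> W - {0}"
  obtains T where "linear T" "T ` U = W" "\<And>x. x \<in> U \<Longrightarrow> norm (T x) = norm x"
    "\<And>x y. x \<in> X \<Longrightarrow> y \<in> Y \<Longrightarrow> T x \<bullet> y \<noteq> 0"
proof -
  obtain F F' where F: "linear F" "F ` U = W" "\<And>x. x \<in> U \<Longrightarrow> norm (F x) = norm x"
    and F': "F' ` W = U" "\<And>y. y \<in> W \<Longrightarrow> norm (F' y) = norm y" "\<And>y. y \<in> W \<Longrightarrow> F (F' y) = y"
    using isometries_subspaces[OF U W dim] by metis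
  \<comment> \<open>The vectors of \<open>Y\<close> are pulled back to \<open>U\<close> by
    \<open>F'\<close>, since \<open>F (R x) \<bullet> y = R x \<bullet> F' y\<close> for the
    reflection \<open>R\<close> below.\<close>
  have "\<exists>v\<in>U. \<forall>(f, g)\<in>X \<times> F' ` Y. reflection_form f g v \<noteq> 0"
  proof (rule reflection_form_simultaneously_nonzero[OF U])
    fix f g assume "(f, g) \<in> X \<times> F' ` Y"
    then obtain y where "f \<in> X" "y \<in> Y" "g = F' y" by auto
    then show "f \<in> U \<and> g \<in> U \<and> f \<noteq> 0 \<and> g \<noteq> 0"
      using X Y F' by (metis Diff_iff image_eqI insertI1 norm_eq_zero subset_eq)
  qed (use X Y in auto)
  then obtain v where v: "v \<in> U"
    "\<And>f y. f \<in> X \<Longrightarrow> y \<in> Y \<Longrightarrow> reflection_form f (F' y) v \<noteq> 0" by auto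
  \<comment> \<open>Reflection in the hyperplane orthogonal to \<open>v\<close>. If
    \<open>v = 0\<close>, which is possible when \<open>X\<close> or \<open>Y\<close> is empty,
    \<open>R\<close> is the identity.\<close>
  define R where "R x = x - (2 * (v \<bullet> x) / (v \<bullet> v)) *\<^sub>R v" for x
  have R_lin: "linear R"
    by (rule linearI) (auto simp: R_def inner_add_right algebra_simps add_divide_distrib)
  have R_U: "R x \<in> U" if "x \<in> U" for x
    using that U v by (simp add: R_def subspace_diff subspace_scale)
  have RR: "R (R x) = x" for x
    by (cases "v = 0") (simp_all add: R_def inner_diff_right)
  have R_norm: "norm (R x) = norm x" for x
  proof -
    have "R x \<bullet> R x = x \<bullet> x"
      by (cases "v = 0") (simp_all add: R_def inner_diff_left inner_diff_right inner_commute[of x v])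
    then show ?thesis by (simp add: norm_eq)
  qed
  have "R ` U = U"
    using R_U RR by (metis image_eqI image_subsetI subsetI subset_antisym)
  show ?thesis
  proof
    show "linear (F \<circ> R)"
      using R_lin F(1) by (rule linear_compose)
    show "(F \<circ> R) ` U = W"
      using \<open>R ` U = U\<close> F(2) by (metis image_comp)
    show "norm ((F \<circ> R) x) = norm x" if "x \<in> U" for x
      using that F(3) R_U R_norm by simp
    show "(F \<circ> R) x \<bullet> y \<noteq> 0" if "x \<in> X" "y \<in> Y" for x y
    proof -
      have "x \<in> U" "y \<in> W" using that X Y by auto
      then have "F (R x) \<bullet> F (F' y) = R x \<bullet> F' y"
        using F' by (intro linear_isometry_inner[OF F(1) U F(3)] R_U) auto
      then have *: "(F \<circ> R) x \<bullet> y = R x \<bullet> F' y"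
        using F' \<open>y \<in> W\<close> by simp
      have nz: "reflection_form x (F' y) v \<noteq> 0" using v that by blast
      then have "v \<noteq> 0" by (auto simp: reflection_form_def)
      then have "reflection_form x (F' y) v = (v \<bullet> v) * (R x \<bullet> F' y)"
        by (simp add: R_def reflection_form_def inner_diff_left right_diff_distrib)
      then show ?thesis using nz * by auto
    qed
  qed
qed

section \<open>Block vectors and block matrices\<close>

text \<open>Polymorphic in the entries, so that it both concatenates real vectors and stacks the
  rows of a matrix.\<close>

definition vec_join :: "'a^'v \<Rightarrow> 'a^'w \<Rightarrow> 'a^('v + 'w)" where
  "vec_join u w = (\<chi> s. case s of Inl i \<Rightarrow> u $ i | Inr j \<Rightarrow> w $ j)"

lemma vec_join_nth [simp]: "vec_join u w $ Inl i = u $ i" "vec_join u w $ Inr j = w $ j"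
  by (simp_all add: vec_join_def)

lemma vec_join_eq_iff: "vec_join u w = vec_join u' w' \<longleftrightarrow> u = u' \<and> w = w'"
  by (auto simp: vec_eq_iff split_sum_all)

lemma vec_join_cases: obtains u w where "x = vec_join u w"
proof
  show "x = vec_join (\<chi> i. x $ Inl i) (\<chi> j. x $ Inr j)"
    by (simp add: vec_eq_iff split_sum_all)
qed

definition block_matrix ::
  "real^'v^'v \<Rightarrow> real^'w^'v \<Rightarrow> real^'v^'w \<Rightarrow> real^'w^'w \<Rightarrow> real^('v + 'w)^('v + 'w)" where
  "block_matrix P N M Q = vec_join (\<chi> i. vec_join (P $ i) (N $ i)) (\<chi> j. vec_join (M $ j) (Q $ j))"

lemma sum_UNIV_Plus:
  fixes f :: "'v::finite + 'w::finite \<Rightarrow> 'a::comm_monoid_add"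
  shows "sum f UNIV = (\<Sum>i\<in>UNIV. f (Inl i)) + (\<Sum>j\<in>UNIV. f (Inr j))"
  using sum.Plus[of UNIV UNIV f] by simp

lemma block_matrix_mult:
  "block_matrix P N M Q *v vec_join u w = vec_join (P *v u + N *v w) (M *v u + Q *v w)"
  by (simp add: vec_eq_iff split_sum_all block_matrix_def matrix_vector_mult_def sum_UNIV_Plus)

section \<open>The matrix of the join\<close>

text \<open>The common \<open>k\<close> makes the ranges of the two projections equidimensional, as
  an isometry of one onto the other requires.\<close>

lemma achieves_bipartition_join:
  fixes G :: "'v::finite \<Rightarrow> 'v \<Rightarrow> bool" and H :: "'w::finite \<Rightarrow> 'w \<Rightarrow> bool"
  assumes G: "simple_graph G" "no_isolated_vertices G" "achieves_bipartition G k"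
    and H: "simple_graph H" "no_isolated_vertices H" "achieves_bipartition H k"
  shows "achieves_bipartition (graph_join G H) k"
proof -
  obtain P where P: "P \<in> sym_matrices G" "\<And>x. P *v (P *v x) = P *v x" "dim (eigenspace P 1) = k"
    using achieves_bipartition_projection[OF G(3)] by blast
  obtain Q where Q: "Q \<in> sym_matrices H" "\<And>x. Q *v (Q *v x) = Q *v x" "dim (eigenspace Q 1) = k"
    using achieves_bipartition_projection[OF H(3)] by blast
  have Psym: "transpose P = P" and Qsym: "transpose Q = Q"
    using P(1) Q(1) by (auto simp: sym_matrices_def)
  define U where "U = eigenspace P 1"
  define W where "W = eigenspace Q 1"
  have U: "subspace U" and W: "subspace W"
    by (simp_all add: U_def W_def subspace_eigenspace)
  have U_iff: "x \<in> U \<longleftrightarrow> P *v x = x" for x by (simp add: U_def eigenspace_def)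
  have W_iff: "x \<in> W \<longleftrightarrow> Q *v x = x" for x by (simp add: W_def eigenspace_def)
  \<comment> \<open>The finite sets to be kept non-orthogonal are the columns of \<open>P\<close>
    and \<open>Q\<close>: the entries of \<open>M\<close> will be the inner products
    \<open>T x \<bullet> y\<close>.\<close>
  obtain T where T: "linear T" "T ` U = W" "\<And>x. x \<in> U \<Longrightarrow> norm (T x) = norm x"
    and T_nz: "\<And>x y. x \<in> range (\<lambda>i. P *v axis i 1) \<Longrightarrow> y \<in> range (\<lambda>j. Q *v axis j 1) \<Longrightarrow> T x \<bullet> y \<noteq> 0"
  proof (rule isometry_in_general_position[OF U W])
    show "dim U = dim W" using P(3) Q(3) by (simp add: U_def W_def)
    show "range (\<lambda>i. P *v axis i 1) \<subseteq> U - {0}"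
      using column_nonzero_if_not_isolated[OF G(1,2) P(1)] P(2) by (auto simp: U_iff)
    show "range (\<lambda>j. Q *v axis j 1) \<subseteq> W - {0}"
      using column_nonzero_if_not_isolated[OF H(1,2) Q(1)] Q(2) by (auto simp: W_iff)
  qed auto
  define M :: "real^'v^'w" where "M = matrix (\<lambda>x. T (P *v x))"
  have M: "M *v x = T (P *v x)" for x
  proof -
    have "linear (\<lambda>x. T (P *v x))"
      using linear_compose[OF matrix_vector_mul_linear[of P] T(1)] by (simp add: o_def)
    then show ?thesis by (simp add: M_def matrix_works)
  qed
  have MU: "M *v u = T u" if "u \<in> U" for u
    using that by (simp add: M U_iff)
  have PU: "P *v x \<in> U" for x by (simp add: U_iff P(2))
  have QW: "Q *v y \<in> W" for y by (simp add: W_iff Q(2))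
  have MP: "M *v (P *v x) = M *v x" for x by (simp add: M P(2))
  have QM: "Q *v (M *v x) = M *v x" for x
    using T(2) PU[of x] by (metis M W_iff image_eqI)
  \<comment> \<open>\<open>M\<close> is a partial isometry with initial projection \<open>P\<close>
    and final projection \<open>Q\<close>. The first half is tested against every
    \<open>z\<close>.\<close>
  have MtM: "transpose M *v (M *v x) = P *v x" for x
  proof -
    have "(transpose M *v (M *v x)) \<bullet> z = (P *v x) \<bullet> z" for z
    proof -
      have "(transpose M *v (M *v x)) \<bullet> z = T (P *v x) \<bullet> T (P *v z)"
        by (simp add: transpose_inner M)
      also have "\<dots> = (P *v x) \<bullet> (P *v z)"
        by (rule linear_isometry_inner[OF T(1) U T(3) PU PU])
      also have "\<dots> = (P *v x) \<bullet> z"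
        by (metis P(2) Psym symmetric_inner)
      finally show ?thesis .
    qed
    then show ?thesis by (metis vector_eq_rdot)
  qed
  have MtQ: "transpose M *v (Q *v y) = transpose M *v y" for y
  proof -
    have "(transpose M *v (Q *v y)) \<bullet> z = (transpose M *v y) \<bullet> z" for z
      by (simp add: transpose_inner symmetric_inner[OF Qsym] QM)
    then show ?thesis by (metis vector_eq_rdot)
  qed
  \<comment> \<open>Surjectivity of \<open>T\<close> gives \<open>Q *v y = M *v u\<close> with
    \<open>u\<close> fixed by \<open>P\<close>. Replacing \<open>y\<close> by \<open>Q *v y\<close>
    under \<open>transpose M\<close> then reduces the claim to \<open>MtM\<close>.\<close>
  have MMt: "M *v (transpose M *v y) = Q *v y" for y
  proof -
    obtain u where u: "u \<in> U" "Q *v y = M *v u"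
      using QW[of y] T(2) MU by (metis imageE)
    then show ?thesis
      by (metis MtQ MtM U_iff)
  qed
  have PMt: "P *v (transpose M *v y) = transpose M *v y" for y
    by (metis MMt MtM MtQ)
  define C where "C = block_matrix P (transpose M) M Q"
  have C: "C *v vec_join u w = vec_join (P *v u + transpose M *v w) (M *v u + Q *v w)" for u w
    by (simp add: C_def block_matrix_mult)
  have C_mem: "C \<in> sym_matrices (graph_join G H)"
  proof -
    \<comment> \<open>\<open>Q\<close> fixes the range of \<open>M\<close>, and by symmetry it can
      be moved onto the basis vector \<open>axis j 1\<close>.\<close>
    have M_nz: "M $ j $ i \<noteq> 0" for i j
    proof -
      have "M $ j $ i = (M *v axis i 1) $ j"
        by (simp add: matrix_vector_mult_basis column_def)
      also have "\<dots> = (Q *v (M *v axis i 1)) \<bullet> axis j 1"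
        by (simp add: QM inner_axis)
      also have "\<dots> = T (P *v axis i 1) \<bullet> (Q *v axis j 1)"
        by (simp add: symmetric_inner[OF Qsym] M)
      finally show ?thesis using T_nz by auto
    qed
    have PT: "P $ i $ j = P $ j $ i" for i j
      using Psym by (metis transpose_def vec_lambda_beta)
    have QT: "Q $ i $ j = Q $ j $ i" for i j
      using Qsym by (metis transpose_def vec_lambda_beta)
    have "transpose C = C"
      by (simp add: vec_eq_iff split_sum_all C_def block_matrix_def transpose_def PT[symmetric] QT[symmetric])
    moreover have "C $ x $ y \<noteq> 0 \<longleftrightarrow> graph_join G H x y" if "x \<noteq> y" for x y
      using that P(1) Q(1) M_nz
      by (cases x; cases y) (auto simp: C_def block_matrix_def sym_matrices_def transpose_def)
    ultimately show ?thesis by (simp add: sym_matrices_def)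
  qed
  \<comment> \<open>By the partial isometry identities, each block of the square is a sum of two
    copies of the corresponding block of \<open>C\<close>.\<close>
  have CC: "C *v (C *v x) = 2 *\<^sub>R (C *v x)" for x
    by (cases x rule: vec_join_cases)
      (simp add: C matrix_vector_right_distrib P(2) Q(2) MtM MtQ MMt PMt MP QM,
       simp add: vec_eq_iff split_sum_all)
  have sum: "{x + y | x y. x \<in> eigenspace C 0 \<and> y \<in> eigenspace C 2} = UNIV"
  proof -
    have "x - (1/2) *\<^sub>R (C *v x) \<in> eigenspace C 0" "(1/2) *\<^sub>R (C *v x) \<in> eigenspace C 2" for x
      by (simp_all add: eigenspace_def matrix_vector_mult_diff_distrib matrix_vector_mult_scaleR CC)
    then show ?thesis
      by (auto simp: set_eq_iff) (metis diff_add_cancel)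
  qed
  have E2: "eigenspace C 2 = (\<lambda>u. vec_join u (M *v u)) ` U"
  proof (intro set_eqI iffI)
    fix x assume x: "x \<in> eigenspace C 2"
    obtain u w where uw: "x = vec_join u w" by (rule vec_join_cases)
    have "vec_join (P *v u + transpose M *v w) (M *v u + Q *v w) = vec_join (2 *\<^sub>R u) (2 *\<^sub>R w)"
      using x by (simp add: uw eigenspace_def C) (simp add: vec_eq_iff split_sum_all)
    then have 1: "P *v u + transpose M *v w = 2 *\<^sub>R u" and 2: "M *v u + Q *v w = 2 *\<^sub>R w"
      by (auto simp: vec_join_eq_iff)
    \<comment> \<open>Applying \<open>M\<close> to the first row equation reproduces the left side
      of the second, which forces \<open>w = M *v u\<close>.\<close>
    have "M *v u + Q *v w = 2 *\<^sub>R (M *v u)"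
      using arg_cong[OF 1, of "(*v) M"]
      by (simp add: matrix_vector_right_distrib matrix_vector_mult_scaleR MP MMt)
    with 2 have w: "w = M *v u" by simp
    have "P *v u + P *v u = 2 *\<^sub>R u" using 1 by (simp add: w MtM)
    then have "u \<in> U" by (simp add: U_iff flip: scaleR_2)
    then show "x \<in> (\<lambda>u. vec_join u (M *v u)) ` U" using uw w by blast
  next
    fix x assume "x \<in> (\<lambda>u. vec_join u (M *v u)) ` U"
    then obtain u where u: "P *v u = u" "x = vec_join u (M *v u)" by (auto simp: U_iff)
    then show "x \<in> eigenspace C 2"
      by (simp add: eigenspace_def C MtM QM) (simp add: vec_eq_iff split_sum_all)
  qed
  have lin: "linear (\<lambda>u. vec_join u (M *v u))"
    by (rule linearI) (simp_all add: vec_eq_iff split_sum_all matrix_vector_right_distrib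
        matrix_vector_mult_scaleR)
  \<comment> \<open>The parametrisation by \<open>U\<close> is injective because its first component
    is \<open>u\<close>.\<close>
  have m2: "eigen_mult C 2 = k"
    unfolding eigen_mult_def E2 using P(3)
    by (subst dim_image_eq[OF lin]) (auto simp: inj_on_def vec_join_eq_iff U_def)
  have k: "1 \<le> k" "k \<le> CARD('v) div 2" "k \<le> CARD('w) div 2"
    using G(3) H(3) by (auto simp: achieves_bipartition_def)
  have card: "CARD('v + 'w) = CARD('v) + CARD('w)"
    by simp
  have m0: "eigen_mult C 0 = CARD('v + 'w) - k"
    using eigen_mult_add[OF _ sum] m2 by simp
  have "eigenvalues C = {0, 2}"
  proof
    \<comment> \<open>Both multiplicities are positive: \<open>k\<close> is at least 1 and smaller
      than the order of the join.\<close>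
    show "{0, 2} \<subseteq> eigenvalues C"
      using m0 m2 k card by (auto simp: eigenvalues_iff_eigen_mult)
    show "eigenvalues C \<subseteq> {0, 2}"
    proof
      fix c assume "c \<in> eigenvalues C"
      then obtain x where x: "x \<noteq> 0" "C *v x = c *\<^sub>R x" by (auto simp: eigenvalues_def)
      with CC[of x] have "(c * c) *\<^sub>R x = (2 * c) *\<^sub>R x"
        by (simp add: matrix_vector_mult_scaleR)
      then show "c \<in> {0, 2}" using x by auto
    qed
  qed
  moreover have "k \<le> CARD('v + 'w) div 2" using k card by linarith
  ultimately show ?thesis
    unfolding achieves_bipartition_def
    using C_mem k m0 m2 by (metis zero_neq_numeral)
qed

theorem theorem3p8:
  fixes G :: "'v::finite \<Rightarrow> 'v \<Rightarrow> bool" and H :: "'w::finite \<Rightarrow> 'w \<Rightarrow> bool"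
  assumes "simple_graph G" and "simple_graph H"
    and "no_isolated_vertices G" and "no_isolated_vertices H"
    and "q_graph G = 2" and "q_graph H = 2"
    and "MB G = MB H"
  shows "q_graph (graph_join G H) = 2 \<and> MB (graph_join G H) \<le> MB G"
proof
  have ach: "achieves_bipartition (graph_join G H) (MB G)"
    using assms achieves_bipartition_MB[of G] achieves_bipartition_MB[of H]
    by (intro achieves_bipartition_join) auto
  then show "MB (graph_join G H) \<le> MB G"
    unfolding MB_def[of "graph_join G H"] by (rule Least_le)
  show "q_graph (graph_join G H) = 2"
    unfolding q_graph_def
  proof (rule Least_equality)
    obtain A a b where "A \<in> sym_matrices (graph_join G H)" "a \<noteq> b" "eigenvalues A = {a, b}"
      using ach by (auto simp: achieves_bipartition_def)
    then show "\<exists>A\<in>sym_matrices (graph_join G H). num_eigenvalues A = 2"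
      by (intro bexI[of _ A]) (auto simp: num_eigenvalues_def)
  next
    fix m assume "\<exists>A\<in>sym_matrices (graph_join G H). num_eigenvalues A = m"
    \<comment> \<open>Any vertex of \<open>G\<close> and any vertex of \<open>H\<close> are adjacent
      in the join; \<open>undefined\<close> supplies one of each.\<close>
    then show "2 \<le> m"
      using num_eigenvalues_ge_2[of _ "graph_join G H" "Inl undefined" "Inr undefined"] by auto
  qed
qed

end
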